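(* Let $(\mathbf{x},\mathbf{y},B,\mathbf{Z})$ be a generalized seed over a semifield $\mathbb{P}$, with $d_i=\deg Z_i$ and $D=(d_i\delta_{ij})$, placed at the initial vertex $t_0$ of $\mathbb{T}_n$. Let $\mathbf{c}^t_j=(c^t_{ij})_i$ be the $c$-vectors of the generalized cluster algebra $\mathcal{A}(\mathbf{x},\mathbf{y},B,\mathbf{Z})$, let ${}^L\mathbf{c}^t_j=({}^Lc^t_{ij})_i$ be the $c$-vectors of its left-companion cluster algebra $\mathcal{A}(\mathbf{x}^{1/\mathbf{d}},\mathbf{y},DB)$, and let ${}^R\mathbf{c}^t_j=({}^Rc^t_{ij})_i$ be the $c$-vectors of its right-companion cluster algebra $\mathcal{A}(\mathbf{x},\mathbf{y}^{\mathbf{d}},BD)$, where $\mathbf{x}^{1/\mathbf{d}}=(x_1^{1/d_1},\dots,x_n^{1/d_n})$ and $\mathbf{y}^{\mathbf{d}}=(y_1^{d_1},\dots,y_n^{d_n})$. Then for all $t\in\mathbb{T}_n$ and $1\le i,j\le n$: $${}^Lc^t_{ij}=c^t_{ij}\qquad\text{and}\qquad {}^Rc^t_{ij}=d_i^{-1}\,c^t_{ij}\,d_j .$$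
   Context: Semifields. A semifield is a multiplicative abelian group $\mathbb{P}$ with an associative, commutative operation $\oplus$ over which multiplication distributes. $\mathbb{P}$ is torsion-free, $\mathbb{ZP}$ is its group ring (a domain), $\mathbb{QP}$ its field of fractions. $\mathbb{Q}_{\mathrm{sf}}(u_1,\dots,u_m)$ is the universal semifield of rational functions in $u_1,\dots,u_m$ that can be written in subtraction-free form (usual operations). $\mathrm{Trop}(u_1,\dots,u_m)$ is the free abelian multiplicative group on the $u_j$ with $\prod u_j^{a_j}\oplus\prod u_j^{b_j}=\prod u_j^{\min(a_j,b_j)}$. Write $[b]_+=\max(b,0)$. Generalized seeds. A generalized seed $(\mathbf{x},\mathbf{y},B,\mathbf{Z})$ over $\mathbb{P}$ consists of: algebraically independent elements $\mathbf{x}=(x_1,\dots,x_n)$ (cluster variables) of a degree-$n$ purely transcendental extension $\mathcal{F}$ of $\mathbb{QP}$ (identified with $\mathbb{QP}(\mathbf{x})$); $\mathbf{y}=(y_1,\dots,y_n)\in\mathbb{P}^n$ (coefficients); a skew-symmetrizable integer $n\times n$ matrix $B=(b_{ij})$; and polynomials $\mathbf{Z}=(Z_1,\dots,Z_n)$, $Z_i(u)=\sum_{s=0}^{d_i}z_{i,s}u^s$ with $d_i\ge1$, $z_{i,s}\in\mathbb{P}$, $z_{i,0}=z_{i,d_i}=1$. Put $\mathbf{z}=(z_{i,s})$ and $Z_i|_{\mathbb{P}}(y)=\bigoplus_{s=0}^{d_i}z_{i,s}y^s$ for $y\in\mathbb{P}$. Mutation. $\mu_k(\mathbf{x},\mathbf{y},B,\mathbf{Z})=(\mathbf{x}',\mathbf{y}',B',\mathbf{Z}')$,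 where $x_i'=x_i$ for $i\ne k$ and $x_k'x_k=\big(\prod_i x_i^{[-b_{ik}]_+}\big)^{d_k}\frac{Z_k(\hat y_k)}{Z_k|_{\mathbb{P}}(y_k)}$ with $\hat y_k=y_k\prod_i x_i^{b_{ik}}$; $y_k'=y_k^{-1}$ and $y_j'=y_j(y_k^{d_k})^{[b_{kj}]_+}Z_k|_{\mathbb{P}}(y_k)^{-b_{kj}}$ for $j\ne k$; $b'_{ij}=-b_{ij}$ if $i=k$ or $j=k$, and $b'_{ij}=b_{ij}+[b_{ik}]_+d_kb_{kj}+b_{ik}d_k[-b_{kj}]_+$ otherwise; $Z_i'=Z_i$ for $i\neq k$ and $Z_k'(u)=u^{d_k}Z_k(u^{-1})$. Patterns. $\mathbb{T}_n$ is the $n$-regular tree with edges labeled by $1,\dots,n$ so that the edges at each vertex have distinct labels. A generalized cluster pattern assigns to each $t\in\mathbb{T}_n$ a generalized seed $(\mathbf{x}^t,\mathbf{y}^t,B^t,\mathbf{Z}^t)$ so that seeds at the ends of an edge labeled $k$ are related by $\mu_k$; it is determined by the seed at the initial vertex $t_0$ (for which the superscript is dropped). The generalized cluster algebra $\mathcal{A}(\mathbf{x},\mathbf{y},B,\mathbf{Z})$ is the $\mathbb{ZP}$-subalgebra of $\mathcal{F}$ generated by all $x_i^t$. An ordinary seed $(\mathbf{x},\mathbf{y},B)$, its cluster pattern and its cluster algebra $\mathcal{A}(\mathbf{x},\mathbf{y},B)$ are the special case $Z_i(u)=1+u$ for all $i$ (so all $d_i=1$, and there are no variables $z_{i,s}$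 with $0<s<d_i$). $c$-vectors. Regard $y_i$ and $z_{i,s}$ ($0<s<d_i$) as independent indeterminates. $Y$-functions $Y_j^t\in\mathbb{Q}_{\mathrm{sf}}(\mathbf{y},\mathbf{z})$ are the coefficients obtained by performing the $y$-mutations in $\mathbb{P}=\mathbb{Q}_{\mathrm{sf}}(\mathbf{y},\mathbf{z})$ starting from $\mathbf{y}$ at $t_0$. Their images under the semifield homomorphism to $\mathrm{Trop}(\mathbf{y},\mathbf{z})$ fixing the generators are monomials $\prod_i y_i^{c^t_{ij}}$; the vectors $\mathbf{c}^t_j=(c^t_{ij})_i\in\mathbb{Z}^n$ are the $c$-vectors. They depend only on the initial exchange matrix and the degrees $d_i$; for an ordinary cluster algebra they are computed with its own initial coefficients regarded as the indeterminates. *)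

theory Defs
  imports "HOL-Analysis.Cartesian_Space" "HOL-Library.Poly_Mapping"
    "HOL-Computational_Algebra.Fraction_Field"
begin

section \<open>Semifields\<close>

text \<open>The semifield addition is written \<open>+\<close>; there is no zero element.\<close>

class semifield = comm_semiring + comm_monoid_mult + inverse +
  assumes semifield_left_inverse: "inverse a * a = 1"
    and semifield_divide: "a / b = a * inverse b"

definition semifield_hom :: "('a::semifield \<Rightarrow> 'b::semifield) \<Rightarrow> bool" where
  "semifield_hom f \<longleftrightarrow> (\<forall>a b. f (a * b) = f a * f b) \<and> (\<forall>a b. f (a + b) = f a + f b)"

text \<open>The sum \<open>f 0 + \<dots> + f d\<close>; \<^const>\<open>sum\<close> is not available without a zero.\<close>

primrec oplus_upto :: "(nat \<Rightarrow> 'a::semifield) \<Rightarrow> nat \<Rightarrow> 'a" where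
  "oplus_upto f 0 = f 0"
| "oplus_upto f (Suc d) = oplus_upto f d + f (Suc d)"


subsection \<open>The universal semifield\<close>

type_synonym 'v polyn = "('v \<Rightarrow>\<^sub>0 nat) \<Rightarrow>\<^sub>0 rat"

text \<open>The rational functions over \<open>\<rat>\<close> in the indeterminates \<open>'v\<close>. (The linear order on \<open>'v\<close> is only
  needed because the library proves integrality of polynomial rings by means of it.)\<close>

type_synonym 'v ratfun = "'v polyn fract"

definition rf_gen :: "'v::linorder \<Rightarrow> 'v ratfun" where
  "rf_gen v = Fract (Poly_Mapping.single (Poly_Mapping.single v 1) 1) 1"

inductive_set subtraction_free :: "'v::linorder ratfun set" where
  sf_one: "1 \<in> subtraction_free"
| sf_gen: "rf_gen v \<in> subtraction_free"
| sf_add: "a \<in> subtraction_free \<Longrightarrow> b \<in> subtraction_free \<Longrightarrow> a + b \<in> subtraction_free"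
| sf_mult: "a \<in> subtraction_free \<Longrightarrow> b \<in> subtraction_free \<Longrightarrow> a * b \<in> subtraction_free"
| sf_divide: "a \<in> subtraction_free \<Longrightarrow> b \<in> subtraction_free \<Longrightarrow> a / b \<in> subtraction_free"

definition pos_polyn :: "'v polyn \<Rightarrow> bool" where
  "pos_polyn p \<longleftrightarrow> p \<noteq> 0 \<and> (\<forall>m. 0 \<le> Poly_Mapping.lookup p m)"

lemma pos_polyn_add:
  assumes "pos_polyn p" "pos_polyn q"
  shows "pos_polyn (p + q)"
proof -
  obtain m where "Poly_Mapping.lookup p m \<noteq> 0"
    using assms(1) by (auto simp: pos_polyn_def poly_mapping_eq_iff fun_eq_iff)
  moreover have "Poly_Mapping.lookup p m \<ge> 0" "Poly_Mapping.lookup q m \<ge> 0"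
    using assms by (simp_all add: pos_polyn_def)
  ultimately have "Poly_Mapping.lookup (p + q) m > 0" by (simp add: lookup_add)
  then have "p + q \<noteq> 0" by auto
  with assms show ?thesis by (auto simp: pos_polyn_def lookup_add)
qed

lemma pos_polyn_mult:
  fixes p q :: "'v::linorder polyn"
  assumes "pos_polyn p" "pos_polyn q"
  shows "pos_polyn (p * q)"
proof -
  have "0 \<le> Poly_Mapping.lookup (p * q) m" for m
    unfolding lookup_mult Sum_any.expand_set
    using assms by (intro sum_nonneg mult_nonneg_nonneg) (auto simp: pos_polyn_def when_def)
  with assms show ?thesis by (auto simp: pos_polyn_def)
qed

lemma pos_polyn_1: "pos_polyn (1 :: 'v polyn)"
  by (auto simp: pos_polyn_def lookup_one when_def)

lemma subtraction_free_Fract: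
  assumes "a \<in> subtraction_free"
  shows "\<exists>p q. pos_polyn p \<and> pos_polyn q \<and> a = Fract p q"
  using assms
proof induction
  case sf_one
  show ?case using pos_polyn_1 One_fract_def by blast
next
  case (sf_gen v)
  have "pos_polyn (Poly_Mapping.single (Poly_Mapping.single v (1::nat)) 1)"
    unfolding pos_polyn_def
    by (metis lookup_single_eq lookup_single_not_eq lookup_zero order_refl zero_le_one zero_neq_one)
  then show ?case using pos_polyn_1 unfolding rf_gen_def by blast
next
  case (sf_add a b)
  then obtain p q p' q' where *: "pos_polyn p" "pos_polyn q" "a = Fract p q"
    "pos_polyn p'" "pos_polyn q'" "b = Fract p' q'" by blast
  from * have "q \<noteq> 0" "q' \<noteq> 0" by (simp_all add: pos_polyn_def)
  then have "a + b = Fract (p * q' + p' * q) (q * q')"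
    unfolding *(3,6) by (rule add_fract)
  moreover from * have "pos_polyn (p * q' + p' * q)" "pos_polyn (q * q')"
    by (blast intro: pos_polyn_add pos_polyn_mult)+
  ultimately show ?case by blast
next
  case (sf_mult a b)
  then obtain p q p' q' where *: "pos_polyn p" "pos_polyn q" "a = Fract p q"
    "pos_polyn p'" "pos_polyn q'" "b = Fract p' q'" by blast
  then have "a * b = Fract (p * p') (q * q')"
    by (simp only: mult_fract)
  moreover from * have "pos_polyn (p * p')" "pos_polyn (q * q')"
    by (blast intro: pos_polyn_mult)+
  ultimately show ?case by blast
next
  case (sf_divide a b)
  then obtain p q p' q' where *: "pos_polyn p" "pos_polyn q" "a = Fract p q"
    "pos_polyn p'" "pos_polyn q'" "b = Fract p' q'" by blast
  then have "a / b = Fract (p * q') (q * p')"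
    by (simp only: divide_fract)
  moreover from * have "pos_polyn (p * q')" "pos_polyn (q * p')"
    by (blast intro: pos_polyn_mult)+
  ultimately show ?case by blast
qed

lemma subtraction_free_nonzero: "a \<in> subtraction_free \<Longrightarrow> a \<noteq> 0"
  by (drule subtraction_free_Fract) (auto simp: pos_polyn_def Zero_fract_def eq_fract)

typedef (overloaded) 'v qsf = "subtraction_free :: 'v::linorder ratfun set"
  using sf_one by blast

setup_lifting type_definition_qsf

instantiation qsf :: (linorder) semifield
begin

lift_definition one_qsf :: "'a qsf" is 1 by (rule sf_one)
lift_definition plus_qsf :: "'a qsf \<Rightarrow> 'a qsf \<Rightarrow> 'a qsf" is "(+)" by (rule sf_add)
lift_definition times_qsf :: "'a qsf \<Rightarrow> 'a qsf \<Rightarrow> 'a qsf" is "(*)" by (rule sf_mult)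
lift_definition divide_qsf :: "'a qsf \<Rightarrow> 'a qsf \<Rightarrow> 'a qsf" is "(/)" by (rule sf_divide)
lift_definition inverse_qsf :: "'a qsf \<Rightarrow> 'a qsf" is inverse
  by (metis sf_one sf_divide inverse_eq_divide)

instance
  by standard (transfer; auto simp: algebra_simps subtraction_free_nonzero divide_inverse)+

end

lift_definition qsf_gen :: "'v::linorder \<Rightarrow> 'v qsf" is rf_gen by (rule sf_gen)


subsection \<open>The tropical semifield\<close>

text \<open>A Laurent monomial is represented by its finitely supported exponent function.\<close>

typedef 'v trop = "UNIV :: ('v \<Rightarrow>\<^sub>0 int) set" morphisms trop_exponents Trop
  by simp

setup_lifting type_definition_trop

lift_definition pm_min :: "('v \<Rightarrow>\<^sub>0 int) \<Rightarrow> ('v \<Rightarrow>\<^sub>0 int) \<Rightarrow> ('v \<Rightarrow>\<^sub>0 int)" is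
  "\<lambda>a b v. min (a v) (b v)"
proof -
  fix a b :: "'v \<Rightarrow> int"
  assume "finite {v. a v \<noteq> 0}" "finite {v. b v \<noteq> 0}"
  then show "finite {v. min (a v) (b v) \<noteq> 0}"
    by (rule finite_subset[OF _ finite_UnI, rotated]) (auto simp: min_def split: if_splits)
qed

instantiation trop :: (type) semifield
begin

lift_definition one_trop :: "'a trop" is 0 .
lift_definition times_trop :: "'a trop \<Rightarrow> 'a trop \<Rightarrow> 'a trop" is "(+)" .
lift_definition plus_trop :: "'a trop \<Rightarrow> 'a trop \<Rightarrow> 'a trop" is pm_min .
lift_definition inverse_trop :: "'a trop \<Rightarrow> 'a trop" is uminus .
lift_definition divide_trop :: "'a trop \<Rightarrow> 'a trop \<Rightarrow> 'a trop" is "(-)" .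

instance
  by standard
    (transfer; auto intro!: poly_mapping_eqI simp: pm_min.rep_eq lookup_add ac_simps min_add_distrib_left
      min_add_distrib_right)+

end

lift_definition trop_gen :: "'v \<Rightarrow> 'v trop" is "\<lambda>v. Poly_Mapping.single v 1" .

definition trop_exponent :: "'v trop \<Rightarrow> 'v \<Rightarrow> int" where
  "trop_exponent m v = Poly_Mapping.lookup (trop_exponents m) v"

text \<open>The semifield homomorphism to the tropical semifield that fixes the generators; it exists and
  is unique by the universal property of the semifield of subtraction-free rational functions.\<close>

definition tropicalize :: "'v::linorder qsf \<Rightarrow> 'v trop" where
  "tropicalize = (THE f. semifield_hom f \<and> (\<forall>v. f (qsf_gen v) = trop_gen v))"


section \<open>Generalized seeds\<close>

text \<open>The index set \<open>{1, \<dots>, n}\<close> is a finite linearly ordered type \<open>'n\<close>. An exchange polynomial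
  \<open>Z\<^sub>i\<close> is the list \<open>[z\<^sub>i\<^sub>,\<^sub>0, \<dots>, z\<^sub>i\<^sub>,\<^sub>d]\<close> of its coefficients, all of which lie in the semifield; its
  degree is the length minus one.\<close>

type_synonym 'n intvec = "int^'n"
type_synonym 'n intmat = "int^'n^'n"

record ('n::finite, 'p) yseed =
  yvar :: "'n \<Rightarrow> 'p"
  exmat :: "'n intmat"
  expol :: "'n \<Rightarrow> 'p list"

record ('n::finite, 'p, 'f) seed = "('n, 'p) yseed" +
  xvar :: "'n \<Rightarrow> 'f"

definition exdeg :: "('n::finite, 'p, 'b) yseed_scheme \<Rightarrow> 'n \<Rightarrow> nat" where
  "exdeg S i = length (expol S i) - 1"

definition degmat :: "('n::finite \<Rightarrow> nat) \<Rightarrow> 'n intmat" where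
  "degmat d = (\<chi> i j. if i = j then int (d i) else 0)"

definition skew_symmetrizable :: "('n::finite) intmat \<Rightarrow> bool" where
  "skew_symmetrizable B \<longleftrightarrow>
     (\<exists>r :: 'n \<Rightarrow> int. (\<forall>i. r i > 0) \<and> (\<forall>i j. r i * B $ i $ j = - (r j * B $ j $ i)))"

text \<open>A map \<open>\<iota>\<close> from the semifield \<open>\<P>\<close> to a field which extends to an injective ring homomorphism
  on the group ring \<open>\<int>\<P>\<close>; then \<open>group_ring \<iota>\<close> is a copy of \<open>\<int>\<P>\<close> and \<open>group_field \<iota>\<close> one of \<open>\<rat>\<P>\<close>.\<close>

definition group_ring_embedding :: "('p::semifield \<Rightarrow> 'f::field) \<Rightarrow> bool" where
  "group_ring_embedding \<iota> \<longleftrightarrow> \<iota> 1 = 1 \<and> (\<forall>a b. \<iota> (a * b) = \<iota> a * \<iota> b) \<and>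
     (\<forall>c :: 'p \<Rightarrow>\<^sub>0 int. (\<Sum>p\<in>Poly_Mapping.keys c. of_int (Poly_Mapping.lookup c p) * \<iota> p) = 0 \<longrightarrow> c = 0)"

definition group_ring :: "('p::semifield \<Rightarrow> 'f::field) \<Rightarrow> 'f set" where
  "group_ring \<iota> =
     range (\<lambda>c :: 'p \<Rightarrow>\<^sub>0 int. \<Sum>p\<in>Poly_Mapping.keys c. of_int (Poly_Mapping.lookup c p) * \<iota> p)"

definition group_field :: "('p::semifield \<Rightarrow> 'f::field) \<Rightarrow> 'f set" where
  "group_field \<iota> = {a / b | a b. a \<in> group_ring \<iota> \<and> b \<in> group_ring \<iota> \<and> b \<noteq> 0}"

definition polys_over :: "'f::field set \<Rightarrow> (('n \<Rightarrow>\<^sub>0 nat) \<Rightarrow>\<^sub>0 'f) set" where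
  "polys_over K = {p. \<forall>m. Poly_Mapping.lookup p m \<in> K}"

definition poly_eval :: "(('n::finite \<Rightarrow>\<^sub>0 nat) \<Rightarrow>\<^sub>0 'f::field) \<Rightarrow> ('n \<Rightarrow> 'f) \<Rightarrow> 'f" where
  "poly_eval p x =
     (\<Sum>m\<in>Poly_Mapping.keys p. Poly_Mapping.lookup p m * (\<Prod>i\<in>UNIV. x i ^ Poly_Mapping.lookup m i))"

definition alg_independent :: "'f::field set \<Rightarrow> ('n::finite \<Rightarrow> 'f) \<Rightarrow> bool" where
  "alg_independent K x \<longleftrightarrow> (\<forall>p\<in>polys_over K. poly_eval p x = 0 \<longrightarrow> p = 0)"

definition generates_field :: "'f::field set \<Rightarrow> ('n::finite \<Rightarrow> 'f) \<Rightarrow> bool" where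
  "generates_field K x \<longleftrightarrow>
     (\<forall>f. \<exists>p\<in>polys_over K. \<exists>q\<in>polys_over K. poly_eval q x \<noteq> 0 \<and> f = poly_eval p x / poly_eval q x)"

text \<open>The ambient field is the whole type \<open>'f\<close>, identified with \<open>\<rat>\<P>(x\<^sub>1, \<dots>, x\<^sub>n)\<close>.\<close>

definition generalized_seed :: "('p::semifield \<Rightarrow> 'f::field) \<Rightarrow> ('n::finite, 'p, 'f) seed \<Rightarrow> bool" where
  "generalized_seed \<iota> S \<longleftrightarrow>
     group_ring_embedding \<iota> \<and>
     alg_independent (group_field \<iota>) (xvar S) \<and> generates_field (group_field \<iota>) (xvar S) \<and>
     skew_symmetrizable (exmat S) \<and>
     (\<forall>i. exdeg S i \<ge> 1 \<and> hd (expol S i) = 1 \<and> last (expol S i) = 1)"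


section \<open>Mutation of coefficients and cluster patterns\<close>

definition pospart :: "int \<Rightarrow> int" where
  "pospart b = max b 0"

definition sf_eval :: "'p::semifield list \<Rightarrow> 'p \<Rightarrow> 'p" where
  "sf_eval zs y = oplus_upto (\<lambda>s. zs ! s * y ^ s) (length zs - 1)"

text \<open>The mutation of \<open>(\<^bold>y, B, \<^bold>Z)\<close>, which does not involve the cluster variables. Reversal of the
  coefficient list is \<open>Z(u) \<mapsto> u\<^sup>d Z(u\<^sup>-\<^sup>1)\<close>.\<close>

definition mutate_y :: "'n \<Rightarrow> ('n::finite, 'p::semifield) yseed \<Rightarrow> ('n, 'p) yseed" where
  "mutate_y k S =
     (let y = yvar S; b = (\<lambda>i j. exmat S $ i $ j); Z = expol S; d = exdeg S in
      \<lparr> yvar = (\<lambda>j. if j = k then inverse (y k)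
                    else y j * (y k ^ d k) powi pospart (b k j) * sf_eval (Z k) (y k) powi (- b k j)),
        exmat = (\<chi> i j. if i = k \<or> j = k then - b i j
                        else b i j + pospart (b i k) * int (d k) * b k j
                                   + b i k * int (d k) * pospart (- b k j)),
        expol = Z(k := rev (Z k)) \<rparr>)"

text \<open>The \<open>n\<close>-regular tree: a vertex is the sequence of labels on the path to it from the initial vertex
  \<open>[]\<close>, that is, a word without two equal adjacent letters.\<close>

definition tree_vertices :: "'n list set" where
  "tree_vertices = {t. distinct_adj t}"

definition tree_edge :: "'n \<Rightarrow> 'n list \<Rightarrow> 'n list \<Rightarrow> bool" where
  "tree_edge k t t' \<longleftrightarrow> t \<in> tree_vertices \<and> t' \<in> tree_vertices \<and> (t' = t @ [k] \<or> t = t' @ [k])"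

text \<open>The pattern is determined by the data at the initial vertex.\<close>

definition yseed_at :: "('n::finite, 'p::semifield) yseed \<Rightarrow> 'n list \<Rightarrow> ('n, 'p) yseed" where
  "yseed_at S t = fold mutate_y t S"

text \<open>Mutation is involutive, so the data at both ends of an edge are related in either direction.\<close>

lemma semifield_cancel: "a * c = b * c \<Longrightarrow> a = (b::'a::semifield)"
  by (metis semifield_left_inverse mult.assoc mult.commute mult_1)

lemma semifield_inverse_unique: "a * b = 1 \<Longrightarrow> inverse a = (b::'a::semifield)"
  by (metis semifield_left_inverse mult.assoc mult.right_neutral mult_1)

lemma oplus_upto_mult: "oplus_upto f d * c = oplus_upto (\<lambda>s. f s * c) d"
  by (induction d) (simp_all add: distrib_right)

lemma oplus_upto_cong: "(\<And>s. s \<le> d \<Longrightarrow> f s = g s) \<Longrightarrow> oplus_upto f d = oplus_upto g d"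
  by (induction d) simp_all

lemma oplus_upto_Suc_shift: "oplus_upto f (Suc d) = f 0 + oplus_upto (\<lambda>s. f (Suc s)) d"
  by (induction d) (simp_all add: add.assoc)

lemma oplus_upto_rev: "oplus_upto (\<lambda>s. f (d - s)) d = oplus_upto f d"
proof (induction d)
  case (Suc d)
  have "oplus_upto (\<lambda>s. f (Suc d - s)) (Suc d) = f (Suc d) + oplus_upto (\<lambda>s. f (d - s)) d"
    by (simp only: oplus_upto_Suc_shift diff_Suc_Suc diff_zero)
  with Suc show ?case by (simp add: add.commute)
qed simp

lemma sf_eval_rev:
  fixes y :: "'a::semifield"
  assumes "zs \<noteq> []"
  shows "sf_eval (rev zs) (inverse y) * y ^ (length zs - 1) = sf_eval zs y"
proof -
  define d where "d = length zs - 1"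
  have inv: "inverse y ^ m * y ^ m = 1" for m
    by (simp add: semifield_left_inverse flip: power_mult_distrib)
  have "rev zs ! s * inverse y ^ s * y ^ d = zs ! (d - s) * y ^ (d - s)" if "s \<le> d" for s
  proof -
    have "rev zs ! s = zs ! (d - s)"
    proof -
      have "s < length zs" using that assms unfolding d_def by (cases zs) auto
      then show ?thesis by (simp add: rev_nth d_def)
    qed
    moreover have "y ^ d = y ^ s * y ^ (d - s)"
      using that by (simp flip: power_add)
    ultimately have "rev zs ! s * inverse y ^ s * y ^ d
        = zs ! (d - s) * (inverse y ^ s * y ^ s) * y ^ (d - s)"
      by (simp only: mult.assoc)
    then show ?thesis by (simp only: inv mult.right_neutral)
  qed
  then have "oplus_upto (\<lambda>s. rev zs ! s * inverse y ^ s * y ^ d) d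
      = oplus_upto (\<lambda>s. zs ! (d - s) * y ^ (d - s)) d"
    by (rule oplus_upto_cong)
  then have "sf_eval (rev zs) (inverse y) * y ^ d = oplus_upto (\<lambda>s. zs ! (d - s) * y ^ (d - s)) d"
    by (simp only: sf_eval_def oplus_upto_mult length_rev flip: d_def)
  also have "\<dots> = sf_eval zs y"
    using oplus_upto_rev[of "\<lambda>s. zs ! s * y ^ s" d] by (simp only: sf_eval_def d_def)
  finally show ?thesis unfolding d_def .
qed

lemma skew_symmetrizable_diag: "skew_symmetrizable B \<Longrightarrow> B $ i $ i = 0"
  unfolding skew_symmetrizable_def by (metis equal_neg_zero less_irrefl mult_eq_0_iff)

lemma pospart_mult: "r > 0 \<Longrightarrow> r * pospart b = pospart (r * b)"
  by (auto simp: pospart_def max_def mult_le_0_iff zero_le_mult_iff)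

lemma pospart_uminus: "pospart (- b) = pospart b - b"
  by (auto simp: pospart_def max_def)

lemma skew_symmetrizable_mutate:
  assumes "skew_symmetrizable (exmat S)"
  shows "skew_symmetrizable (exmat (mutate_y k S))"
proof -
  obtain r where r: "\<And>i. r i > 0"
    and skew: "\<And>i j. r i * exmat S $ i $ j = - (r j * exmat S $ j $ i)"
    using assms unfolding skew_symmetrizable_def by blast
  define b where "b = (\<lambda>i j. exmat S $ i $ j)"
  have sk: "r i * b i j = - (r j * b j i)" for i j
    unfolding b_def by (rule skew)
  have 1: "r i * pospart (b i k) = r k * pospart (- b k i)" for i
    using sk[of i k] by (simp add: pospart_mult r)
  have "r i * exmat (mutate_y k S) $ i $ j = - (r j * exmat (mutate_y k S) $ j $ i)" for i j
  proof (cases "i = k \<or> j = k")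
    case True
    then show ?thesis using sk[of i j] by (auto simp: mutate_y_def Let_def b_def)
  next
    case False
    have e: "r i * exmat (mutate_y k S) $ i $ j = r i * b i j
        + int (exdeg S k) * (r i * pospart (b i k) * b k j + r i * b i k * pospart (- b k j))"
      if "\<not> (i = k \<or> j = k)" for i j
      using that by (simp add: mutate_y_def Let_def b_def algebra_simps)
    have "r i * pospart (b i k) * b k j = pospart (- b k i) * (r k * b k j)"
      by (simp only: 1 mult_ac)
    then have "r i * pospart (b i k) * b k j = - (r j * b j k * pospart (- b k i))"
      unfolding sk[of k j] by (simp add: mult_ac)
    moreover have "r j * pospart (b j k) * b k i = pospart (- b k j) * (r k * b k i)"
      by (simp only: 1 mult_ac)
    then have "r i * b i k * pospart (- b k j) = - (r j * pospart (b j k) * b k i)"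
      unfolding sk[of k i] by (simp add: mult_ac)
    ultimately show ?thesis using False sk[of i j] by (simp add: e algebra_simps)
  qed
  with r show ?thesis unfolding skew_symmetrizable_def by blast
qed

lemma mutate_y_involutive:
  assumes "exmat S $ k $ k = 0" and ne: "expol S k \<noteq> []"
  shows "mutate_y k (mutate_y k S) = S"
proof (rule yseed.equality)
  define d where "d = exdeg S k"
  define y where "y = yvar S k"
  define z where "z = sf_eval (expol S k) y"
  define z' where "z' = sf_eval (rev (expol S k)) (inverse y)"
  have ex: "exmat (mutate_y k S) $ i $ j =
      (if i = k \<or> j = k then - (exmat S $ i $ j)
       else exmat S $ i $ j + pospart (exmat S $ i $ k) * int (exdeg S k) * exmat S $ k $ j
         + exmat S $ i $ k * int (exdeg S k) * pospart (- (exmat S $ k $ j)))" for S i j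
    by (simp add: mutate_y_def Let_def)
  have d': "exdeg (mutate_y k S) k = d"
    by (simp add: exdeg_def mutate_y_def Let_def d_def)
  have zz: "z' * y ^ d = z"
    using sf_eval_rev[OF ne] by (simp add: z_def z'_def d_def exdeg_def)
  have iy: "inverse (inverse y) = y"
    by (rule semifield_inverse_unique) (rule semifield_left_inverse)
  show "yvar (mutate_y k (mutate_y k S)) = yvar S"
  proof
    fix j
    show "yvar (mutate_y k (mutate_y k S)) j = yvar S j"
    proof (cases "j = k")
      case True
      then show ?thesis using iy by (simp add: mutate_y_def Let_def y_def)
    next
      case False
      define b where "b = exmat S $ k $ j"
      have "yvar (mutate_y k (mutate_y k S)) j =
          yvar S j * ((y ^ d) powi pospart b * z powi (- b) *
            ((inverse y ^ d) powi pospart (- b) * z' powi b))"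
        using False d' by (simp add: mutate_y_def Let_def y_def z_def z'_def b_def d_def mult.assoc)
      also have "(y ^ d) powi pospart b * z powi (- b) *
            ((inverse y ^ d) powi pospart (- b) * z' powi b) = 1"
      proof (cases "b \<ge> 0")
        case True
        then obtain m where m: "b = int m" using nonneg_int_cases by blast
        have "(y ^ d) powi pospart b * z powi (- b) * ((inverse y ^ d) powi pospart (- b) * z' powi b)
            = (inverse z * (z' * y ^ d)) ^ m"
          by (cases m) (simp_all add: m pospart_def power_int_def power_mult_distrib nat_add_distrib
              mult_ac)
        then show ?thesis by (simp add: zz semifield_left_inverse)
      next
        case False
        then obtain m where m: "b = - int m" by (metis int_cases2 of_nat_0_le_iff)
        have m0: "m > 0" using False m by simp
        have "(y ^ d) powi pospart b * z powi (- b) * ((inverse y ^ d) powi pospart (- b) * z' powi b)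
            = (z * inverse y ^ d * inverse z') ^ m"
          using m0 by (simp add: m pospart_def power_int_def power_mult_distrib mult_ac)
        also have "z * inverse y ^ d * inverse z' = (inverse z' * z') * (inverse y * y) ^ d"
          by (simp add: zz[symmetric] power_mult_distrib mult_ac)
        finally show ?thesis by (simp add: semifield_left_inverse)
      qed
      finally show ?thesis by simp
    qed
  qed
  show "exmat (mutate_y k (mutate_y k S)) = exmat S"
    using assms(1) by (simp add: vec_eq_iff ex d') (simp add: d_def pospart_uminus algebra_simps)
  show "expol (mutate_y k (mutate_y k S)) = expol S"
    by (simp add: mutate_y_def Let_def)
qed simp

lemma yseed_at_admissible:
  assumes "skew_symmetrizable (exmat S)" "\<And>i. expol S i \<noteq> []"
  shows "skew_symmetrizable (exmat (yseed_at S t)) \<and> (\<forall>i. expol (yseed_at S t) i \<noteq> [])"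
proof (induction t rule: rev_induct)
  case (snoc k t)
  have "yseed_at S (t @ [k]) = mutate_y k (yseed_at S t)" by (simp add: yseed_at_def)
  moreover have "expol (mutate_y k (yseed_at S t)) i \<noteq> []" for i
    using snoc by (simp add: mutate_y_def Let_def)
  ultimately show ?case using snoc skew_symmetrizable_mutate by metis
qed (simp add: assms yseed_at_def)

lemma yseed_at_edge:
  assumes "skew_symmetrizable (exmat S)" "\<And>i. expol S i \<noteq> []" "tree_edge k t t'"
  shows "yseed_at S t' = mutate_y k (yseed_at S t)"
proof (cases "t' = t @ [k]")
  case False
  with assms have "yseed_at S t = mutate_y k (yseed_at S t')"
    by (auto simp: tree_edge_def yseed_at_def)
  then show ?thesis
    using mutate_y_involutive yseed_at_admissible[OF assms(1,2)] skew_symmetrizable_diag by metis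
qed (simp add: yseed_at_def)


section \<open>\<open>c\<close>-vectors\<close>

datatype 'n indet = Yind 'n | Zind 'n nat

text \<open>An arbitrary linear order, needed only to form \<^typ>\<open>'n indet qsf\<close>.\<close>

fun indet_rank :: "'n indet \<Rightarrow> 'n \<times> nat" where
  "indet_rank (Yind i) = (i, 0)"
| "indet_rank (Zind i s) = (i, Suc s)"

lemma indet_rank_inject: "indet_rank a = indet_rank b \<longleftrightarrow> a = b"
  by (cases a; cases b) auto

instantiation indet :: (linorder) linorder
begin

definition less_eq_indet :: "'a indet \<Rightarrow> 'a indet \<Rightarrow> bool" where
  "a \<le> b \<longleftrightarrow> fst (indet_rank a) < fst (indet_rank b) \<or>
     fst (indet_rank a) = fst (indet_rank b) \<and> snd (indet_rank a) \<le> snd (indet_rank b)"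

definition less_indet :: "'a indet \<Rightarrow> 'a indet \<Rightarrow> bool" where
  "a < b \<longleftrightarrow> a \<le> b \<and> \<not> b \<le> (a :: 'a indet)"

instance
proof
  fix a b c :: "'a indet"
  show "a < b \<longleftrightarrow> a \<le> b \<and> \<not> b \<le> a" by (rule less_indet_def)
  show "a \<le> a" by (simp add: less_eq_indet_def)
  show "a \<le> c" if "a \<le> b" "b \<le> c" using that by (auto simp: less_eq_indet_def)
  show "a = b" if "a \<le> b" "b \<le> a"
    using that by (auto simp: less_eq_indet_def prod_eq_iff simp flip: indet_rank_inject)
  show "a \<le> b \<or> b \<le> a" by (auto simp: less_eq_indet_def)
qed

end

text \<open>The initial data with indeterminate coefficients. The indeterminates \<open>Zind i s\<close> with \<open>s = 0\<close> or
  \<open>s \<ge> d i\<close> do not occur.\<close>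

definition universal_yseed ::
  "'n intmat \<Rightarrow> ('n::{finite,linorder} \<Rightarrow> nat) \<Rightarrow> ('n, 'n indet qsf) yseed" where
  "universal_yseed B d =
     \<lparr> yvar = (\<lambda>i. qsf_gen (Yind i)),
       exmat = B,
       expol = (\<lambda>i. map (\<lambda>s. if s = 0 \<or> s = d i then 1 else qsf_gen (Zind i s)) [0..<Suc (d i)]) \<rparr>"

definition Y_function :: "('n::{finite,linorder}, 'p, 'f) seed \<Rightarrow> 'n list \<Rightarrow> 'n \<Rightarrow> 'n indet qsf" where
  "Y_function S t j = yvar (yseed_at (universal_yseed (exmat S) (exdeg S)) t) j"

definition c_vector :: "('n::{finite,linorder}, 'p, 'f) seed \<Rightarrow> 'n list \<Rightarrow> 'n \<Rightarrow> 'n intvec" where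
  "c_vector S t j = (\<chi> i. trop_exponent (tropicalize (Y_function S t j)) (Yind i))"


section \<open>Companion seeds\<close>

definition ordinary_seed ::
  "('n::finite \<Rightarrow> 'f) \<Rightarrow> ('n \<Rightarrow> 'p::semifield) \<Rightarrow> 'n intmat \<Rightarrow> ('n, 'p, 'f) seed" where
  "ordinary_seed x y B = \<lparr> yvar = y, exmat = B, expol = (\<lambda>i. [1, 1]), xvar = x \<rparr>"

definition field_hom :: "('f::field \<Rightarrow> 'g::field) \<Rightarrow> bool" where
  "field_hom h \<longleftrightarrow> h 1 = 1 \<and> (\<forall>a b. h (a + b) = h a + h b) \<and> (\<forall>a b. h (a * b) = h a * h b)"

text \<open>The roots \<open>w\<^sub>i = x\<^sub>i\<^bsup>1/d\<^sub>i\<^esup>\<close> live in an extension \<open>\<epsilon>\<close> of the ambient field.\<close>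

definition cluster_roots :: "('f::field \<Rightarrow> 'g::field) \<Rightarrow> ('n::finite, 'p, 'f) seed \<Rightarrow> ('n \<Rightarrow> 'g) \<Rightarrow> bool" where
  "cluster_roots \<epsilon> S w \<longleftrightarrow> field_hom \<epsilon> \<and> (\<forall>i. w i ^ exdeg S i = \<epsilon> (xvar S i))"

definition left_companion ::
  "('n::finite \<Rightarrow> 'g) \<Rightarrow> ('n, 'p::semifield, 'f) seed \<Rightarrow> ('n, 'p, 'g) seed" where
  "left_companion w S = ordinary_seed w (yvar S) (degmat (exdeg S) ** exmat S)"

definition right_companion ::
  "('n::finite, 'p::semifield, 'f) seed \<Rightarrow> ('n, 'p, 'f) seed" where
  "right_companion S =
     ordinary_seed (xvar S) (\<lambda>i. yvar S i ^ exdeg S i) (exmat S ** degmat (exdeg S))"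

end

theory Submission
  imports Defs
begin

text \<open>Since \<open>z\<^sub>k\<^sub>,\<^sub>s\<close> does not contribute to the exponents of \<open>\<^bold>y\<close>, tropicalizing the mutation rule gives
  \<open>c'\<^sub>i\<^sub>j = c\<^sub>i\<^sub>j + d\<^sub>k (c\<^sub>i\<^sub>k [b\<^sub>k\<^sub>j]\<^sub>+ + b\<^sub>k\<^sub>j [-c\<^sub>i\<^sub>k]\<^sub>+)\<close> for \<open>j \<noteq> k\<close>; no sign-coherence is needed. Replacing \<open>d\<close>
  by \<open>1\<close>, \<open>b\<^sub>i\<^sub>j\<close> by \<open>l\<^sub>i b\<^sub>i\<^sub>j r\<^sub>j\<close> and \<open>c\<^sub>i\<^sub>j\<close> by \<open>c\<^sub>i\<^sub>j r\<^sub>j / r\<^sub>i\<close>, where \<open>d\<^sub>k = l\<^sub>k r\<^sub>k\<close>, preserves this recursion and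
  that of the exchange matrices, because \<open>[\<cdot>]\<^sub>+\<close> commutes with multiplication by positive numbers.
  That tropicalization exists rests on the absence of cancellation: the minimal exponent of a variable
  is additive on products of polynomials with nonnegative coefficients.\<close>

section \<open>The tropicalization homomorphism\<close>

lemma keys_pos_mult_memI:
  fixes p q :: "'v::linorder polyn"
  assumes p: "pos_polyn p" and q: "pos_polyn q"
    and a: "a \<in> Poly_Mapping.keys p" and b: "b \<in> Poly_Mapping.keys q"
  shows "a + b \<in> Poly_Mapping.keys (p * q)"
proof -
  \<comment> \<open>Splitting off one monomial of each factor isolates a positive contribution to
    the coefficient at \<open>a + b\<close>; the remaining products are nonnegative and cannot
    cancel it.\<close>
  define p1 where "p1 = Poly_Mapping.single a (Poly_Mapping.lookup p a)"
  define q1 where "q1 = Poly_Mapping.single b (Poly_Mapping.lookup q b)"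
  have nonneg_mult: "Poly_Mapping.lookup (f * g) m \<ge> 0"
    if "\<And>m. Poly_Mapping.lookup f m \<ge> 0" "\<And>m. Poly_Mapping.lookup g m \<ge> 0"
    for f g :: "'v polyn" and m
  \<comment> \<open>\<open>pos_polyn\<close> excludes 0, while \<open>p - p1\<close> and
    \<open>q - q1\<close> may vanish.\<close>
  proof (cases "f = 0 \<or> g = 0")
    case False
    then have "pos_polyn (f * g)"
      using that by (intro pos_polyn_mult) (auto simp: pos_polyn_def)
    then show ?thesis by (simp add: pos_polyn_def)
  qed auto
  have nonneg: "Poly_Mapping.lookup (p - p1) m \<ge> 0" "Poly_Mapping.lookup p1 m \<ge> 0"
    "Poly_Mapping.lookup (q - q1) m \<ge> 0" "Poly_Mapping.lookup q m \<ge> 0" for m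
    using p q by (auto simp: pos_polyn_def p1_def q1_def lookup_minus lookup_single when_def)
  have "p * q = p1 * q1 + (p1 * (q - q1) + (p - p1) * q)"
    by (simp add: algebra_simps)
  then have "Poly_Mapping.lookup (p * q) (a + b) \<ge> Poly_Mapping.lookup (p1 * q1) (a + b)"
    using nonneg_mult[of p1 "q - q1" "a + b"] nonneg_mult[of "p - p1" q "a + b"] nonneg
    by (simp add: lookup_add)
  moreover have "Poly_Mapping.lookup (p1 * q1) (a + b)
      = Poly_Mapping.lookup p a * Poly_Mapping.lookup q b"
    by (simp add: p1_def q1_def mult_single)
  moreover have "Poly_Mapping.lookup p a > 0" "Poly_Mapping.lookup q b > 0"
    using p q a b by (simp_all add: pos_polyn_def in_keys_iff order_less_le)
  ultimately have "Poly_Mapping.lookup (p * q) (a + b) > 0"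
    by (metis mult_pos_pos order_less_le_trans)
  then show ?thesis by (simp add: in_keys_iff)
qed

lemma keys_pos_mult:
  fixes p q :: "'v::linorder polyn"
  assumes "pos_polyn p" "pos_polyn q"
  shows "Poly_Mapping.keys (p * q) = {a + b | a b. a \<in> Poly_Mapping.keys p \<and> b \<in> Poly_Mapping.keys q}"
  using keys_mult[of p q] keys_pos_mult_memI[OF assms] by blast

lemma keys_pos_add:
  assumes "pos_polyn p" "pos_polyn q"
  shows "Poly_Mapping.keys (p + q) = Poly_Mapping.keys p \<union> Poly_Mapping.keys q"
  using assms by (auto simp: pos_polyn_def in_keys_iff lookup_add add_nonneg_eq_0_iff)

text \<open>For nonzero \<open>p\<close> this is the exponent of the largest power of the
  indeterminate \<open>v\<close> dividing \<open>p\<close>.\<close>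

definition min_exponent :: "'v polyn \<Rightarrow> 'v \<Rightarrow> nat" where
  "min_exponent p v = Min ((\<lambda>m. Poly_Mapping.lookup m v) ` Poly_Mapping.keys p)"

lemma keys_pos_polyn: "pos_polyn p \<Longrightarrow> Poly_Mapping.keys p \<noteq> {}"
  by (simp add: pos_polyn_def)

lemma min_exponent_le: "m \<in> Poly_Mapping.keys p \<Longrightarrow> min_exponent p v \<le> Poly_Mapping.lookup m v"
  by (simp add: min_exponent_def)

lemma min_exponent_attained:
  assumes "pos_polyn p"
  obtains m where "m \<in> Poly_Mapping.keys p" "min_exponent p v = Poly_Mapping.lookup m v"
proof -
  have "min_exponent p v \<in> (\<lambda>m. Poly_Mapping.lookup m v) ` Poly_Mapping.keys p"
    unfolding min_exponent_def using keys_pos_polyn[OF assms] by (intro Min_in) auto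
  then show thesis using that by blast
qed

lemma min_exponent_mult:
  fixes p q :: "'v::linorder polyn"
  assumes p: "pos_polyn p" and q: "pos_polyn q"
  shows "min_exponent (p * q) v = min_exponent p v + min_exponent q v"
proof (rule antisym)
  obtain a where a: "a \<in> Poly_Mapping.keys p" "min_exponent p v = Poly_Mapping.lookup a v"
    using min_exponent_attained[OF p] .
  obtain b where b: "b \<in> Poly_Mapping.keys q" "min_exponent q v = Poly_Mapping.lookup b v"
    using min_exponent_attained[OF q] .
  show "min_exponent (p * q) v \<le> min_exponent p v + min_exponent q v"
    using min_exponent_le[OF keys_pos_mult_memI[OF p q a(1) b(1)], of v] a b by (simp add: lookup_add)
  obtain m where m: "m \<in> Poly_Mapping.keys (p * q)" "min_exponent (p * q) v = Poly_Mapping.lookup m v"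
    using min_exponent_attained[OF pos_polyn_mult[OF p q]] .
  then obtain a' b' where "m = a' + b'" "a' \<in> Poly_Mapping.keys p" "b' \<in> Poly_Mapping.keys q"
    using keys_pos_mult[OF p q] by blast
  with m show "min_exponent p v + min_exponent q v \<le> min_exponent (p * q) v"
    by (simp add: lookup_add add_mono min_exponent_le)
qed

lemma min_exponent_add:
  assumes "pos_polyn p" "pos_polyn q"
  shows "min_exponent (p + q) v = min (min_exponent p v) (min_exponent q v)"
  unfolding min_exponent_def keys_pos_add[OF assms] image_Un
  using keys_pos_polyn assms by (intro Min_Un) auto

text \<open>A single monomial of \<open>p\<close> bounds all minimal exponents. Finiteness allows
  them to be read back from \<open>Abs_poly_mapping\<close>.\<close>

lemma finite_min_exponent:
  assumes "pos_polyn p"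
  shows "finite {v. int (min_exponent p v) \<noteq> 0}"
proof -
  obtain m where "m \<in> Poly_Mapping.keys p" using keys_pos_polyn[OF assms] by blast
  then have "{v. int (min_exponent p v) \<noteq> 0} \<subseteq> Poly_Mapping.keys m"
    by (metis (mono_tags, lifting) in_keys_iff le_zero_eq mem_Collect_eq min_exponent_le of_nat_0 subsetI)
  then show ?thesis by (rule finite_subset) simp
qed

section \<open>Tropicalizing subtraction-free rational functions\<close>

definition trop_polyn :: "'v polyn \<Rightarrow> 'v trop" where
  "trop_polyn p = Trop (Abs_poly_mapping (\<lambda>v. int (min_exponent p v)))"

lemma trop_exponent_mult: "trop_exponent (a * b) v = trop_exponent a v + trop_exponent b v"
  by (simp add: trop_exponent_def times_trop.rep_eq lookup_add)

lemma trop_exponent_add: "trop_exponent (a + b) v = min (trop_exponent a v) (trop_exponent b v)"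
  by (simp add: trop_exponent_def plus_trop.rep_eq pm_min.rep_eq)

lemma trop_exponent_divide: "trop_exponent (a / b) v = trop_exponent a v - trop_exponent b v"
  by (simp add: trop_exponent_def divide_trop.rep_eq lookup_minus)

lemma trop_exponent_gen: "trop_exponent (trop_gen u) v = (if u = v then 1 else 0)"
  by (simp add: trop_exponent_def trop_gen.rep_eq lookup_single when_def)

lemma trop_eqI: "(\<And>v. trop_exponent a v = trop_exponent b v) \<Longrightarrow> a = b"
  by (metis trop_exponent_def poly_mapping_eqI trop_exponents_inject)

lemma trop_exponent_polyn:
  "pos_polyn p \<Longrightarrow> trop_exponent (trop_polyn p) v = int (min_exponent p v)"
  unfolding trop_exponent_def trop_polyn_def
  by (subst Trop_inverse, simp, subst Abs_poly_mapping_inverse) (simp_all only: mem_Collect_eq finite_min_exponent)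

definition qsf_trop :: "'v::linorder qsf \<Rightarrow> 'v trop" where
  "qsf_trop a = (SOME w. \<exists>p q. pos_polyn p \<and> pos_polyn q \<and> Rep_qsf a = Fract p q \<and>
                   w = trop_polyn p / trop_polyn q)"

text \<open>Cross-multiplication and additivity of minimal exponents make the value independent of
  the representing fraction, so the choice in \<open>qsf_trop\<close> is harmless.\<close>

lemma trop_polyn_fraction_cong:
  fixes p q :: "'v::linorder polyn"
  assumes pos: "pos_polyn p" "pos_polyn q" "pos_polyn p'" "pos_polyn q'"
    and eq: "Fract p q = Fract p' q'"
  shows "trop_polyn p / trop_polyn q = trop_polyn p' / trop_polyn q'"
proof (rule trop_eqI)
  fix v
  from pos have "q \<noteq> 0" "q' \<noteq> 0" by (simp_all add: pos_polyn_def)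
  with eq have "p * q' = p' * q" by (simp add: eq_fract)
  then have "min_exponent p v + min_exponent q' v = min_exponent p' v + min_exponent q v"
    using pos by (metis min_exponent_mult)
  then show "trop_exponent (trop_polyn p / trop_polyn q) v
      = trop_exponent (trop_polyn p' / trop_polyn q') v"
    using pos by (simp add: trop_exponent_divide trop_exponent_polyn)
qed

lemma qsf_trop_Fract:
  assumes "pos_polyn p" "pos_polyn q" "Rep_qsf a = Fract p q"
  shows "qsf_trop a = trop_polyn p / trop_polyn q"
  unfolding qsf_trop_def
proof (rule some_equality)
  show "\<exists>p' q'. pos_polyn p' \<and> pos_polyn q' \<and> Rep_qsf a = Fract p' q' \<and>
      trop_polyn p / trop_polyn q = trop_polyn p' / trop_polyn q'"
    using assms by blast
  show "w = trop_polyn p / trop_polyn q"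
    if "\<exists>p' q'. pos_polyn p' \<and> pos_polyn q' \<and> Rep_qsf a = Fract p' q' \<and>
      w = trop_polyn p' / trop_polyn q'" for w
  proof -
    from that obtain p' q' where w: "pos_polyn p'" "pos_polyn q'" "Rep_qsf a = Fract p' q'"
      "w = trop_polyn p' / trop_polyn q'" by blast
    show ?thesis
      unfolding w(4) by (rule trop_polyn_fraction_cong) (use assms w in auto)
  qed
qed

lemma qsf_Fract:
  obtains p q where "pos_polyn p" "pos_polyn q" "Rep_qsf a = Fract p q"
  using subtraction_free_Fract[OF Rep_qsf] by blast

lemma semifield_hom_qsf_trop: "semifield_hom (qsf_trop :: 'v::linorder qsf \<Rightarrow> 'v trop)"
  unfolding semifield_hom_def
proof (intro conjI allI)
  fix a b :: "'v qsf"
  obtain p q where a: "pos_polyn p" "pos_polyn q" "Rep_qsf a = Fract p q" by (rule qsf_Fract)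
  obtain p' q' where b: "pos_polyn p'" "pos_polyn q'" "Rep_qsf b = Fract p' q'" by (rule qsf_Fract)
  have nz: "q \<noteq> 0" "q' \<noteq> 0" using a b by (simp_all add: pos_polyn_def)
  have "Rep_qsf (a * b) = Fract (p * p') (q * q')"
    by (simp add: times_qsf.rep_eq a(3) b(3))
  then have ab: "qsf_trop (a * b) = trop_polyn (p * p') / trop_polyn (q * q')"
    using a b by (intro qsf_trop_Fract pos_polyn_mult)
  have "Rep_qsf (a + b) = Fract (p * q' + p' * q) (q * q')"
    by (simp add: plus_qsf.rep_eq a(3) b(3) nz)
  then have a_b: "qsf_trop (a + b) = trop_polyn (p * q' + p' * q) / trop_polyn (q * q')"
    using a b by (intro qsf_trop_Fract pos_polyn_add pos_polyn_mult)
  note exps = trop_exponent_mult trop_exponent_add trop_exponent_divide trop_exponent_polyn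
    min_exponent_add min_exponent_mult pos_polyn_mult pos_polyn_add
  show "qsf_trop (a * b) = qsf_trop a * qsf_trop b"
    unfolding ab qsf_trop_Fract[OF a] qsf_trop_Fract[OF b]
    using a b by (intro trop_eqI) (simp add: exps)
  show "qsf_trop (a + b) = qsf_trop a + qsf_trop b"
    unfolding a_b qsf_trop_Fract[OF a] qsf_trop_Fract[OF b]
    using a b by (intro trop_eqI) (simp add: exps)
qed

lemma qsf_trop_gen: "qsf_trop (qsf_gen v) = trop_gen v"
proof -
  define m where "m = Poly_Mapping.single v (1::nat)"
  define p where "p = Poly_Mapping.single m (1::rat)"
  have keys: "Poly_Mapping.keys p = {m}" by (simp add: p_def)
  have p: "pos_polyn p"
    using keys by (auto simp: pos_polyn_def p_def lookup_single when_def simp flip: keys_eq_empty)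
  have "qsf_trop (qsf_gen v) = trop_polyn p / trop_polyn 1"
    by (rule qsf_trop_Fract[OF p pos_polyn_1]) (simp add: qsf_gen.rep_eq rf_gen_def p_def m_def)
  also have "\<dots> = trop_gen v"
  proof (rule trop_eqI)
    fix u
    have "min_exponent p u = Poly_Mapping.lookup m u" "min_exponent (1 :: 'a polyn) u = 0"
      using keys by (simp_all add: min_exponent_def)
    then show "trop_exponent (trop_polyn p / trop_polyn 1) u = trop_exponent (trop_gen v) u"
      by (simp add: trop_exponent_divide trop_exponent_polyn p pos_polyn_1 trop_exponent_gen m_def
          lookup_single when_def)
  qed
  finally show ?thesis .
qed

section \<open>Uniqueness of the tropicalization homomorphism\<close>

lemma semifield_hom_one: "semifield_hom f \<Longrightarrow> f 1 = 1"
  by (metis semifield_hom_def mult_1 semifield_cancel)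

lemma semifield_hom_divide:
  assumes "semifield_hom f"
  shows "f (a / b) = f a / f b"
proof -
  have "f (inverse b) * f b = 1"
    using assms semifield_hom_one[OF assms] by (metis semifield_hom_def semifield_left_inverse)
  then have "inverse (f b) = f (inverse b)"
    by (metis mult.commute semifield_inverse_unique)
  then show ?thesis using assms by (simp add: semifield_divide semifield_hom_def)
qed

text \<open>Agreement spreads from the generators along the inductive construction of
  subtraction-free functions. This is the uniqueness behind the definite description in
  \<open>tropicalize\<close>.\<close>

lemma semifield_hom_qsf_eqI:
  fixes f g :: "'v::linorder qsf \<Rightarrow> 's::semifield"
  assumes f: "semifield_hom f" and g: "semifield_hom g"
    and gen: "\<And>v. f (qsf_gen v) = g (qsf_gen v)"
  shows "f = g"
proof
  have "f (Abs_qsf a) = g (Abs_qsf a)" if "a \<in> subtraction_free" for a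
    using that
  proof (induction rule: subtraction_free.induct)
    case sf_one
    then show ?case
      using semifield_hom_one[OF f] semifield_hom_one[OF g] by (simp add: one_qsf_def)
  next
    case (sf_gen v)
    then show ?case using gen[of v] by (simp add: qsf_gen_def)
  next
    case (sf_add a b)
    then have "Abs_qsf (a + b) = Abs_qsf a + Abs_qsf b"
      by (simp add: plus_qsf.abs_eq eq_onp_same_args)
    then show ?case using sf_add f g by (simp add: semifield_hom_def)
  next
    case (sf_mult a b)
    then have "Abs_qsf (a * b) = Abs_qsf a * Abs_qsf b"
      by (simp add: times_qsf.abs_eq eq_onp_same_args)
    then show ?case using sf_mult f g by (simp add: semifield_hom_def)
  next
    case (sf_divide a b)
    then have "Abs_qsf (a / b) = Abs_qsf a / Abs_qsf b"
      by (simp add: divide_qsf.abs_eq eq_onp_same_args)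
    then show ?case
      using sf_divide semifield_hom_divide[OF f] semifield_hom_divide[OF g] by simp
  qed
  then show "f a = g a" for a by (metis Rep_qsf Rep_qsf_inverse)
qed

lemma tropicalize_eq: "tropicalize = qsf_trop"
  unfolding tropicalize_def
  by (rule the_equality)
    (auto simp: semifield_hom_qsf_trop qsf_trop_gen intro!: semifield_hom_qsf_eqI)


section \<open>Valuations on semifields\<close>

text \<open>Such a \<open>v\<close> is a homomorphism to the min-plus semifield of integers. The
  intended instance reads off the exponent of one fixed \<open>y_i\<close>, so that the mutation
  rule becomes a scalar recursion.\<close>

locale semifield_valuation =
  fixes v :: "'p::semifield \<Rightarrow> int"
  assumes mult: "v (a * b) = v a + v b"
    and add: "v (a + b) = min (v a) (v b)"
begin

lemma one: "v 1 = 0"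
  using mult[of 1 1] by simp

lemma inverse: "v (inverse a) = - v a"
  using mult[of "inverse a" a] by (simp add: semifield_left_inverse one)

lemma power: "v (a ^ m) = int m * v a"
  by (induction m) (simp_all add: one mult algebra_simps)

lemma power_int: "v (a powi k) = k * v a"
  by (simp add: power_int_def power inverse)

text \<open>The exponents \<open>s * c\<close> are linear in \<open>s\<close>, so their minimum lies
  at an end of the range: at 0 if \<open>c >= 0\<close>, at \<open>m\<close> otherwise.\<close>

lemma oplus_upto:
  assumes "\<And>s. s \<le> m \<Longrightarrow> v (f s) = int s * c"
  shows "v (oplus_upto f m) = min 0 (int m * c)"
  using assms
proof (induction m)
  case (Suc m)
  then have "v (oplus_upto f (Suc m)) = min (min 0 (int m * c)) (int (Suc m) * c)"
    by (simp add: add)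
  also have "\<dots> = min 0 (int (Suc m) * c)"
    by (cases "c \<ge> 0") (auto simp: min_def algebra_simps mult_le_0_iff not_le)
  finally show ?case .
qed simp

lemma sf_eval:
  assumes "\<And>z. z \<in> set zs \<Longrightarrow> v z = 0" "zs \<noteq> []"
  shows "v (sf_eval zs y) = min 0 (int (length zs - 1) * v y)"
  unfolding sf_eval_def
proof (rule oplus_upto)
  fix s assume "s \<le> length zs - 1"
  then have "zs ! s \<in> set zs" using assms(2) by (intro nth_mem) (cases zs, auto)
  then show "v (zs ! s * y ^ s) = int s * v y" by (simp add: mult power assms(1))
qed

definition units :: "('n::finite, 'p) yseed \<Rightarrow> bool" where
  "units U \<longleftrightarrow> (\<forall>i. expol U i \<noteq> [] \<and> (\<forall>z\<in>set (expol U i). v z = 0))"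

lemma units_mutate: "units U \<Longrightarrow> units (mutate_y k U)"
  by (auto simp: units_def mutate_y_def Let_def)

lemma mutate:
  assumes "units U"
  shows "v (yvar (mutate_y k U) j) =
    (if j = k then - v (yvar U k)
     else v (yvar U j) + int (exdeg U k) *
       (v (yvar U k) * pospart (exmat U $ k $ j) + exmat U $ k $ j * pospart (- v (yvar U k))))"
proof -
  \<comment> \<open>This is \<open>min 0 (d * c)\<close> rewritten using \<open>d >= 0\<close>; the
    power \<open>- b\<close> then turns it into the summand \<open>d * b * [-c]_+\<close>.\<close>
  have "v (sf_eval (expol U k) (yvar U k)) = - (int (exdeg U k) * pospart (- v (yvar U k)))"
    using assms by (subst sf_eval) (auto simp: units_def exdeg_def pospart_def max_def min_def
        zero_le_mult_iff mult_le_0_iff)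
  then show ?thesis
    by (simp add: mutate_y_def Let_def mult inverse power power_int algebra_simps)
qed

end

lemma semifield_valuation_trop:
  "semifield_valuation (\<lambda>a. trop_exponent (tropicalize a) u)"
  by unfold_locales
    (simp_all add: tropicalize_eq semifield_hom_qsf_trop[unfolded semifield_hom_def]
      trop_exponent_mult trop_exponent_add)


section \<open>Comparing patterns with rescaled exchange matrices\<close>

lemma exdeg_mutate: "exdeg (mutate_y k U) i = exdeg U i"
  by (simp add: exdeg_def mutate_y_def Let_def)

lemma exmat_mutate:
  "exmat (mutate_y k U) $ i $ j =
     (if i = k \<or> j = k then - exmat U $ i $ j
      else exmat U $ i $ j + pospart (exmat U $ i $ k) * int (exdeg U k) * exmat U $ k $ j
        + exmat U $ i $ k * int (exdeg U k) * pospart (- exmat U $ k $ j))"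
  by (simp add: mutate_y_def Let_def)

lemma pospart_scale: "pospart (int m * b) = int m * pospart b"
  by (auto simp: pospart_def max_def mult_le_0_iff zero_le_mult_iff)

text \<open>In each product of two entries through \<open>k\<close>, the inner factors
  \<open>r k\<close> and \<open>l k\<close> join \<open>exdeg U' k\<close> to form
  \<open>exdeg U k\<close>, leaving the outer factor \<open>l i * r j\<close>.\<close>

lemma exmat_mutate_rescale:
  assumes B: "\<And>i j. exmat U' $ i $ j = int (l i) * int (r j) * exmat U $ i $ j"
    and d: "exdeg U k = l k * exdeg U' k * r k"
  shows "exmat (mutate_y k U') $ i $ j = int (l i) * int (r j) * exmat (mutate_y k U) $ i $ j"
  by (simp add: exmat_mutate B d pospart_scale mult.assoc flip: mult_minus_right)
    (simp add: algebra_simps)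

text \<open>Both companions are instances: \<open>l = d\<close>, \<open>r = 1\<close> gives the left one and \<open>l = 1\<close>, \<open>r = d\<close> the right
  one. Valuations \<open>v\<close> and \<open>v'\<close> reading off the exponent of \<open>y\<^sub>i\<close> are related with \<open>e = r i\<close>.\<close>

lemma rescaled_pattern:
  assumes "semifield_valuation v" and "semifield_valuation v'"
    and "semifield_valuation.units v U" and "semifield_valuation.units v' U'"
    and "\<And>i j. exmat U' $ i $ j = int (l i) * int (r j) * exmat U $ i $ j"
    and "\<And>i. exdeg U i = l i * exdeg U' i * r i"
    and "\<And>j. int e * v' (yvar U' j) = int (r j) * v (yvar U j)"
  shows "int e * v' (yvar (yseed_at U' t) j) = int (r j) * v (yvar (yseed_at U t) j)"
  using assms(3-)
\<comment> \<open>\<open>fold\<close> performs the first mutation of the path first, so the step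
  replaces both initial seeds by their mutations.\<close>
proof (induction t arbitrary: U U')
  case (Cons k t)
  interpret v: semifield_valuation v by fact
  interpret v': semifield_valuation v' by fact
  note B = Cons.prems(3) and d = Cons.prems(4) and y = Cons.prems(5)
  have "int e * v' (yvar (mutate_y k U') j) = int (r j) * v (yvar (mutate_y k U) j)" for j
  proof -
    define b where "b = exmat U $ k $ j"
    define c where "c = v (yvar U k)"
    define c' where "c' = v' (yvar U' k)"
    have ck: "int e * c' = int (r k) * c" by (simp add: y c_def c'_def)
    have pc: "int e * pospart (- c') = int (r k) * pospart (- c)"
      using ck by (simp flip: pospart_scale)
    \<comment> \<open>The factor \<open>l k\<close> comes from row \<open>k\<close> of
      \<open>exmat U'\<close>, the factor \<open>r k\<close> from \<open>ck\<close> and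
      \<open>pc\<close>; with \<open>exdeg U' k\<close> they form \<open>exdeg U k\<close>.\<close>
    have "int e * (int (exdeg U' k) * (c' * pospart (exmat U' $ k $ j)
            + exmat U' $ k $ j * pospart (- c')))
        = int (exdeg U' k) * int (l k) * int (r j)
          * ((int e * c') * pospart b + b * (int e * pospart (- c')))"
      by (simp add: B b_def pospart_scale algebra_simps)
    also have "\<dots> = int (r j) * (int (exdeg U k) * (c * pospart b + b * pospart (- c)))"
      unfolding ck pc d by (simp add: algebra_simps)
    finally show ?thesis
      using y[of j] y[of k]
      by (simp add: v.mutate[OF Cons.prems(1)] v'.mutate[OF Cons.prems(2)] distrib_left
          c_def c'_def b_def)
  qed
  then have "int e * v' (yvar (yseed_at (mutate_y k U') t) j)
      = int (r j) * v (yvar (yseed_at (mutate_y k U) t) j)"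
    by (intro Cons.IH v.units_mutate v'.units_mutate exmat_mutate_rescale Cons.prems)
      (simp_all add: exdeg_mutate d)
  then show ?case by (simp add: yseed_at_def)
qed (simp add: yseed_at_def)

section \<open>Specialization to c-vectors\<close>

lemma trop_exponent_tropicalize_gen:
  "trop_exponent (tropicalize (qsf_gen u)) w = (if u = w then 1 else 0)"
  by (simp add: tropicalize_eq qsf_trop_gen trop_exponent_gen)

lemma units_universal_yseed:
  "semifield_valuation.units (\<lambda>a. trop_exponent (tropicalize a) (Yind i)) (universal_yseed B d)"
  unfolding semifield_valuation.units_def[OF semifield_valuation_trop]
  by (auto simp: universal_yseed_def trop_exponent_tropicalize_gen
      semifield_valuation.one[OF semifield_valuation_trop])

lemma exdeg_universal_yseed: "exdeg (universal_yseed B d) i = d i"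
  by (simp add: exdeg_def universal_yseed_def)

lemma c_vector_rescale:
  assumes B: "\<And>i j. exmat S' $ i $ j = int (l i) * int (r j) * exmat S $ i $ j"
    and d: "\<And>i. exdeg S i = l i * exdeg S' i * r i"
  shows "int (r i) * c_vector S' t j $ i = int (r j) * c_vector S t j $ i"
  unfolding c_vector_def Y_function_def vec_lambda_beta
proof (rule rescaled_pattern[OF semifield_valuation_trop semifield_valuation_trop
      units_universal_yseed units_universal_yseed])
  show "exmat (universal_yseed (exmat S') (exdeg S')) $ i $ j =
      int (l i) * int (r j) * exmat (universal_yseed (exmat S) (exdeg S)) $ i $ j" for i j
    using B by (simp add: universal_yseed_def)
  show "exdeg (universal_yseed (exmat S) (exdeg S)) i =
      l i * exdeg (universal_yseed (exmat S') (exdeg S')) i * r i" for i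
    by (simp add: exdeg_universal_yseed d)
  \<comment> \<open>Each pattern starts from its own indeterminates, so the exponent of
    \<open>y_i\<close> in \<open>y_j\<close> is a Kronecker delta: both sides are \<open>r i\<close>
    if \<open>i = j\<close> and 0 otherwise.\<close>
  show "int (r i) * trop_exponent (tropicalize (yvar (universal_yseed (exmat S') (exdeg S')) j)) (Yind i) =
      int (r j) * trop_exponent (tropicalize (yvar (universal_yseed (exmat S) (exdeg S)) j)) (Yind i)" for j
    by (simp add: universal_yseed_def trop_exponent_tropicalize_gen)
qed

lemma degmat_mult_left: "(degmat d ** B) $ i $ j = int (d i) * B $ i $ j"
  by (simp add: degmat_def matrix_matrix_mult_def if_distrib[of "\<lambda>x. x * _"] cong: if_cong)

lemma degmat_mult_right: "(B ** degmat d) $ i $ j = B $ i $ j * int (d j)"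
  by (simp add: degmat_def matrix_matrix_mult_def if_distrib[of "\<lambda>x. _ * x"] cong: if_cong)

theorem corollary4p1:
  fixes \<iota> :: "'p::semifield \<Rightarrow> 'f::field"
    and S :: "('n::{finite,linorder}, 'p, 'f) seed"
    and \<epsilon> :: "'f \<Rightarrow> 'g::field"
    and w :: "'n \<Rightarrow> 'g"
  assumes "generalized_seed \<iota> S"
    and "cluster_roots \<epsilon> S w"
  shows "\<forall>t\<in>tree_vertices. \<forall>i j.
     c_vector (left_companion w S) t j $ i = c_vector S t j $ i \<and>
     (of_int (c_vector (right_companion S) t j $ i) :: rat) =
       inverse (of_nat (exdeg S i)) * of_int (c_vector S t j $ i) * of_nat (exdeg S j)"
proof (intro ballI allI conjI)
  fix t i j
  show "c_vector (left_companion w S) t j $ i = c_vector S t j $ i"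
    using c_vector_rescale[of "left_companion w S" "exdeg S" "\<lambda>_. 1" S i t j]
    by (simp add: left_companion_def ordinary_seed_def degmat_mult_left) (simp add: exdeg_def)
  have "int (exdeg S i) * c_vector (right_companion S) t j $ i
      = int (exdeg S j) * c_vector S t j $ i"
    by (rule c_vector_rescale[where l = "\<lambda>_. 1"])
      (simp_all add: right_companion_def ordinary_seed_def degmat_mult_right exdeg_def)
  \<comment> \<open>The integer identity is moved to the rationals, where
    \<open>exdeg S i >= 1\<close> permits division.\<close>
  then have "of_nat (exdeg S i) * (of_int (c_vector (right_companion S) t j $ i) :: rat)
      = of_nat (exdeg S j) * of_int (c_vector S t j $ i)"
    by (metis of_int_mult of_int_of_nat_eq)
  moreover have "exdeg S i \<noteq> 0"
    using assms(1) by (metis generalized_seed_def not_one_le_zero)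
  ultimately show "(of_int (c_vector (right_companion S) t j $ i) :: rat) =
      inverse (of_nat (exdeg S i)) * of_int (c_vector S t j $ i) * of_nat (exdeg S j)"
    by (simp add: field_simps)
qed

end
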